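(* Let $n>p\ge 1$ and $T\ge 1$ be integers, let $f$ be a smooth real-valued objective function with Euclidean gradient $\nabla f$, let $\mathcal{R}$ be a retraction on $\mathrm{St}(n,p)$, and let $L>0$ be such that for every $X\in\mathrm{St}(n,p)$ and every $B\in T_X\mathrm{St}(n,p)$, $$f(\mathcal{R}_X(B))\le f(X)+\langle\operatorname{grad}f(X),B\rangle+\frac{L}{2}\|B\|_F^2.$$ Let $X_0\in\mathrm{St}(n,p)$, let $\Delta\ge f(X_0)-\inf_{X\in\mathrm{St}(n,p)}f(X)$, and let $\eta=\sqrt{\frac{2\Delta}{pLT}}$. Let $(X_t)$ be any sequence of iterates generated from $X_0$ by Algorithm 1, or (when $2p\le n$) by Algorithm 2, both as described in the context, with directions $M_t=\nabla f(X_t)$, constant step size $\eta_t=\eta$, and the polar factor evaluated using a thin SVD. Then $$\min_{t\in\{0,\ldots,T-1\}}\|\operatorname{grad}f(X_t)\|_F\le\sqrt{\frac{8p\Delta L}{T}}.$$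
   Context: $\mathrm{St}(n,p)=\{X\in\mathbb{R}^{n\times p}: X^\top X=I_p\}$ with $n>p$ is the Stiefel manifold, with tangent space $T_X\mathrm{St}(n,p)=\{B\in\mathbb{R}^{n\times p}: X^\top B+B^\top X=0\}$. $\langle A,B\rangle=\operatorname{tr}(A^\top B)$ and $\|A\|_F=\sqrt{\langle A,A\rangle}$. For square $A$, $\operatorname{sym}(A)=\frac12(A+A^\top)$ and $\operatorname{skew}(A)=\frac12(A-A^\top)$. The function $f$ is smooth on an open neighbourhood of $\mathrm{St}(n,p)$ in $\mathbb{R}^{n\times p}$, $\nabla f(X)\in\mathbb{R}^{n\times p}$ is its Euclidean gradient, and $\operatorname{grad}f(X)=\mathcal{P}_X(\nabla f(X))$ is its Riemannian gradient with respect to the Frobenius metric, where $\mathcal{P}_X(G)=G-X\operatorname{sym}(X^\top G)$ is the orthogonal projection onto $T_X\mathrm{St}(n,p)$. $\mathcal{R}_X:T_X\mathrm{St}(n,p)\to\mathrm{St}(n,p)$ denotes a retraction (a smooth map, depending smoothly on $X$, with $\mathcal{R}_X(0)=X$ and differential at $0$ equal to the identity). Polar factor via thin SVD: for a square matrix $A\in\mathbb{R}^{k\times k}$, choose any singular value decomposition $A=U\Sigma V^\top$ with $U,V\in\mathbb{R}^{k\times k}$ orthogonal (not unique if $A$ is singular; any choice is allowed), and take the polar factor to be $UV^\top$. Algorithm 1: for $t=0,1,\ldots,T-1$, given $X_t$ and a direction $M_t\in\mathbb{R}^{n\times p}$, set $N_t=\operatorname{skew}(M_tX_t^\top)$; let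 $U_tV_t^\top$ be the polar factor of $N_t$, obtained from any singular value decomposition $N_t=U_t\Sigma_tV_t^\top$ with $U_t,V_t\in\mathbb{R}^{n\times n}$ orthogonal; set $Y_t=-\operatorname{skew}(U_tV_t^\top)$, $B_t=Y_tX_t$, and $X_{t+1}=\mathcal{R}_{X_t}(\eta_tB_t)$. Algorithm 2 (for $2p\le n$): for $t=0,1,\ldots,T-1$, given $X_t$ and a direction $M_t\in\mathbb{R}^{n\times p}$, compute a QR decomposition $\begin{bmatrix}-X_t&M_t\end{bmatrix}=Q_tR_t$ with $Q_t\in\mathbb{R}^{n\times 2p}$ having orthonormal columns and $R_t\in\mathbb{R}^{2p\times 2p}$ upper triangular; with $J=\begin{bmatrix}\mathbf{0}&I_p\\-I_p&\mathbf{0}\end{bmatrix}$, let $U_tV_t^\top$ be the polar factor of $\frac12R_tJR_t^\top$, obtained from any singular value decomposition $\frac12R_tJR_t^\top=U_t\Sigma_tV_t^\top$ with $U_t,V_t\in\mathbb{R}^{2p\times 2p}$ orthogonal; set $\tilde Y_t=-\operatorname{skew}(U_tV_t^\top)$, $B_t=Q_t\big(\tilde Y_t(Q_t^\top X_t)\big)$, and $X_{t+1}=\mathcal{R}_{X_t}(\eta_tB_t)$. *)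

theory Defs
  imports "HOL-Analysis.Analysis"
begin

section \<open>Smooth maps\<close>

primrec Ck_on :: "nat \<Rightarrow> 'a::real_normed_vector set \<Rightarrow> ('a \<Rightarrow> 'b::real_normed_vector) \<Rightarrow> bool"
where
  "Ck_on 0 U f \<longleftrightarrow> continuous_on U f"
| "Ck_on (Suc k) U f \<longleftrightarrow> (\<forall>x\<in>U. f differentiable (at x)) \<and>
     (\<forall>v. Ck_on k U (\<lambda>x. frechet_derivative f (at x) v))"

text \<open>Meant for open \<open>U\<close> in a finite-dimensional space.\<close>

definition smooth_on :: "'a::real_normed_vector set \<Rightarrow> ('a \<Rightarrow> 'b::real_normed_vector) \<Rightarrow> bool" where
  "smooth_on U f \<longleftrightarrow> (\<forall>k. Ck_on k U f)"

text \<open>Smoothness on a subset that need not be open: around each of its points the map agrees with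
  a smooth map on an open set of the ambient space. On an embedded submanifold this is
  smoothness in the sense of manifolds.\<close>

definition smooth_on_subset :: "'a::real_normed_vector set \<Rightarrow> ('a \<Rightarrow> 'b::real_normed_vector) \<Rightarrow> bool"
where
  "smooth_on_subset S f \<longleftrightarrow>
     (\<forall>x\<in>S. \<exists>U g. open U \<and> x \<in> U \<and> smooth_on U g \<and> (\<forall>y\<in>U \<inter> S. g y = f y))"

section \<open>Frobenius geometry and the Stiefel manifold\<close>

definition frob_inner :: "real^'p^'n \<Rightarrow> real^'p^'n \<Rightarrow> real" where
  "frob_inner A B = trace (transpose A ** B)"

definition frob_norm :: "real^'p^'n \<Rightarrow> real" where
  "frob_norm A = sqrt (frob_inner A A)"

lemma frob_inner_eq_inner: "frob_inner A B = A \<bullet> B"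
proof -
  have "frob_inner A B = (\<Sum>j\<in>UNIV. \<Sum>i\<in>UNIV. A $ i $ j * B $ i $ j)"
    by (simp add: frob_inner_def trace_def matrix_matrix_mult_def transpose_def)
  also have "\<dots> = (\<Sum>i\<in>UNIV. \<Sum>j\<in>UNIV. A $ i $ j * B $ i $ j)"
    by (rule sum.swap)
  also have "\<dots> = A \<bullet> B"
    by (simp add: inner_vec_def)
  finally show ?thesis .
qed

lemma frob_norm_eq_norm: "frob_norm A = norm A"
  by (simp add: frob_norm_def frob_inner_eq_inner norm_eq_sqrt_inner)

definition sym_part :: "real^'k^'k \<Rightarrow> real^'k^'k" where
  "sym_part A = (1/2) *\<^sub>R (A + transpose A)"

definition skew_part :: "real^'k^'k \<Rightarrow> real^'k^'k" where
  "skew_part A = (1/2) *\<^sub>R (A - transpose A)"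

definition stiefel :: "(real^'p^'n) set" where
  "stiefel = {X. transpose X ** X = mat 1}"

definition stiefel_tangent :: "real^'p^'n \<Rightarrow> (real^'p^'n) set" where
  "stiefel_tangent X = {B. transpose X ** B + transpose B ** X = 0}"

definition tangent_proj :: "real^'p^'n \<Rightarrow> real^'p^'n \<Rightarrow> real^'p^'n" where
  "tangent_proj X G = G - X ** sym_part (transpose X ** G)"

text \<open>\<open>GDERIV\<close> takes the gradient with respect to \<open>\<bullet>\<close>, which is \<open>frob_inner\<close>.\<close>

definition euclid_grad :: "(real^'p^'n \<Rightarrow> real) \<Rightarrow> real^'p^'n \<Rightarrow> real^'p^'n" where
  "euclid_grad f X = (THE G. GDERIV f X :> G)"

lemma GDERIV_euclid_grad:
  assumes "f differentiable (at X)"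
  shows "GDERIV f X :> euclid_grad f X"
proof -
  obtain f' where f': "(f has_derivative f') (at X)"
    using assms by (auto simp: differentiable_def)
  then have "linear f'"
    by (rule has_derivative_linear)
  then have "f' h = h \<bullet> adjoint f' 1" for h
    by (simp add: adjoint_works)
  then have "f' = (\<lambda>h. h \<bullet> adjoint f' 1)"
    by (rule ext)
  with f' have G: "GDERIV f X :> adjoint f' 1"
    unfolding gderiv_def by (rule has_derivative_eq_rhs)
  have "G = adjoint f' 1" if "GDERIV f X :> G" for G
  proof -
    have "(\<lambda>h. h \<bullet> G) = (\<lambda>h. h \<bullet> adjoint f' 1)"
      using that G unfolding gderiv_def by (rule has_derivative_unique)
    then have "\<forall>h. h \<bullet> G = h \<bullet> adjoint f' 1"
      by (auto dest: fun_cong)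
    then show ?thesis
      by (simp only: vector_eq_ldot)
  qed
  with G show ?thesis
    unfolding euclid_grad_def by (rule theI[where P = "gderiv f X"])
qed

definition riem_grad :: "(real^'p^'n \<Rightarrow> real) \<Rightarrow> real^'p^'n \<Rightarrow> real^'p^'n" where
  "riem_grad f X = tangent_proj X (euclid_grad f X)"

text \<open>A retraction is a map on the tangent bundle; \<open>R X B\<close> is irrelevant unless \<open>X \<in> stiefel\<close> and
  \<open>B \<in> stiefel_tangent X\<close>. Joint smoothness in \<open>(X, B)\<close> expresses the smooth dependence on \<open>X\<close>.\<close>

definition retraction_on_stiefel :: "(real^'p^'n \<Rightarrow> real^'p^'n \<Rightarrow> real^'p^'n) \<Rightarrow> bool" where
  "retraction_on_stiefel R \<longleftrightarrow>
     (\<forall>X\<in>stiefel. \<forall>B\<in>stiefel_tangent X. R X B \<in> stiefel) \<and>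
     smooth_on_subset (SIGMA X:stiefel. stiefel_tangent X) (\<lambda>(X, B). R X B) \<and>
     (\<forall>X\<in>stiefel. R X 0 = X) \<and>
     (\<forall>X\<in>stiefel. (R X has_derivative (\<lambda>H. H)) (at 0 within stiefel_tangent X))"

section \<open>Polar factors\<close>

text \<open>The singular values are not required to be sorted: permuting the columns of \<open>U\<close> and \<open>V\<close>
  simultaneously changes neither \<open>U ** S ** transpose V\<close> (with \<open>S\<close> permuted accordingly) nor
  \<open>U ** transpose V\<close>.\<close>

definition is_svd :: "real^'k^'k \<Rightarrow> real^'k^'k \<Rightarrow> real^'k^'k \<Rightarrow> real^'k^'k \<Rightarrow> bool" where
  "is_svd A U S V \<longleftrightarrow> orthogonal_matrix U \<and> orthogonal_matrix V \<and>
     (\<forall>i j. i \<noteq> j \<longrightarrow> S $ i $ j = 0) \<and> (\<forall>i. S $ i $ i \<ge> 0) \<and>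
     A = U ** S ** transpose V"

definition is_polar_factor :: "real^'k^'k \<Rightarrow> real^'k^'k \<Rightarrow> bool" where
  "is_polar_factor A W \<longleftrightarrow> (\<exists>U S V. is_svd A U S V \<and> W = U ** transpose V)"

section \<open>The two algorithms\<close>

definition alg1_iterates ::
  "(real^'p^'n \<Rightarrow> real^'p^'n \<Rightarrow> real^'p^'n) \<Rightarrow> nat \<Rightarrow> (nat \<Rightarrow> real^'p^'n) \<Rightarrow> (nat \<Rightarrow> real) \<Rightarrow>
   (nat \<Rightarrow> real^'p^'n) \<Rightarrow> bool" where
  "alg1_iterates R T M \<eta> X \<longleftrightarrow>
     (\<forall>t<T. \<exists>W. is_polar_factor (skew_part (M t ** transpose (X t))) W \<and>
        (let Y = - skew_part W; B = Y ** X t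
         in X (Suc t) = R (X t) (\<eta> t *\<^sub>R B)))"

text \<open>Matrices of size \<open>2p\<close> are indexed by \<open>'p + 'p\<close>, where \<open>Inl\<close> is the first block and \<open>Inr\<close> the
  second, so that every \<open>Inl i\<close> precedes every \<open>Inr j\<close>. The linear order on \<open>'p\<close> serves only to give
  meaning to ``upper triangular''.\<close>

definition hblock :: "real^'p^'n \<Rightarrow> real^'p^'n \<Rightarrow> real^('p + 'p)^'n" where
  "hblock A B = (\<chi> i k. case k of Inl j \<Rightarrow> A $ i $ j | Inr j \<Rightarrow> B $ i $ j)"

definition vblock :: "real^'q^'p \<Rightarrow> real^'q^'p \<Rightarrow> real^'q^('p + 'p)" where
  "vblock A B = (\<chi> k. case k of Inl i \<Rightarrow> A $ i | Inr i \<Rightarrow> B $ i)"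

definition Jmat :: "real^('p::finite + 'p)^('p + 'p)" where
  "Jmat = vblock (hblock 0 (mat 1)) (hblock (- mat 1) 0)"

definition upper_tri :: "real^('p::{finite,linorder} + 'p)^('p + 'p) \<Rightarrow> bool" where
  "upper_tri R \<longleftrightarrow>
     (\<forall>i j. j < i \<longrightarrow> R $ Inl i $ Inl j = 0 \<and> R $ Inr i $ Inr j = 0) \<and>
     (\<forall>i j. R $ Inr i $ Inl j = 0)"

definition is_thin_qr ::
  "real^('p::{finite,linorder} + 'p)^'n \<Rightarrow> real^('p + 'p)^'n \<Rightarrow> real^('p + 'p)^('p + 'p) \<Rightarrow> bool"
where
  "is_thin_qr A Q S \<longleftrightarrow> transpose Q ** Q = mat 1 \<and> upper_tri S \<and> A = Q ** S"

definition alg2_iterates ::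
  "(real^'p::{finite,linorder}^'n \<Rightarrow> real^'p::{finite,linorder}^'n \<Rightarrow> real^'p::{finite,linorder}^'n) \<Rightarrow>
   nat \<Rightarrow> (nat \<Rightarrow> real^'p::{finite,linorder}^'n) \<Rightarrow> (nat \<Rightarrow> real) \<Rightarrow>
   (nat \<Rightarrow> real^'p::{finite,linorder}^'n) \<Rightarrow> bool" where
  "alg2_iterates R T M \<eta> X \<longleftrightarrow>
     (\<forall>t<T. \<exists>Q S W. is_thin_qr (hblock (- X t) (M t)) Q S \<and>
        is_polar_factor ((1/2) *\<^sub>R (S ** Jmat ** transpose S)) W \<and>
        (let Y = - skew_part W; B = Q ** (Y ** (transpose Q ** X t))
         in X (Suc t) = R (X t) (\<eta> t *\<^sub>R B)))"

end

theory Submission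
  imports Defs
begin

text \<open>With \<open>G = \<nabla>f(X)\<close> and \<open>N = skew(G X\<^sup>T)\<close>, both algorithms move along \<open>B = Y X\<close> for a skew
  contraction \<open>Y\<close> with \<open>\<langle>N, Y\<rangle> = -\<parallel>N\<parallel>\<^sub>* \<le> -\<parallel>N\<parallel>\<^sub>F\<close>; in the second one \<open>Y\<close> is assembled from the compression
  of \<open>N\<close> to the column space of \<open>Q\<close>, since \<open>N = Q (\<onehalf> R J R\<^sup>T) Q\<^sup>T\<close>. Such a \<open>B\<close> is tangent with
  \<open>\<parallel>B\<parallel>\<^sub>F\<^sup>2 \<le> p\<close> and \<open>\<langle>grad f(X), B\<rangle> = \<langle>N, Y\<rangle>\<close>, while \<open>\<parallel>grad f(X)\<parallel>\<^sub>F \<le> 2 \<parallel>N\<parallel>\<^sub>F\<close>. Hence every step lowers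
  \<open>f\<close> by at least \<open>\<eta> \<parallel>grad f(X)\<parallel>\<^sub>F / 2 - L p \<eta>\<^sup>2 / 2\<close>, and telescoping gives the bound.\<close>

section \<open>Matrix algebra and the Frobenius pairing\<close>

lemma transpose_linear:
  fixes A B :: "real^'m^'n"
  shows "transpose (A + B) = transpose A + transpose B"
    and "transpose (A - B) = transpose A - transpose B"
    and "transpose (- A) = - transpose A"
    and "transpose (c *\<^sub>R A) = c *\<^sub>R transpose A"
  by (simp_all add: transpose_def vec_eq_iff)

lemma matrix_mult_bilinear:
  fixes A A' :: "real^'m^'n" and B B' :: "real^'k^'m"
  shows "A ** (B + B') = A ** B + A ** B'" and "(A + A') ** B = A ** B + A' ** B"
    and "A ** (B - B') = A ** B - A ** B'" and "(A - A') ** B = A ** B - A' ** B"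
    and "A ** (- B) = - (A ** B)" and "(- A) ** B = - (A ** B)"
    and "A ** (c *\<^sub>R B) = c *\<^sub>R (A ** B)" and "(c *\<^sub>R A) ** B = c *\<^sub>R (A ** B)"
  by (simp_all add: matrix_matrix_mult_def vec_eq_iff algebra_simps sum.distrib sum_subtractf
      sum_negf sum_distrib_left)

lemma inner_mult_vec_left:
  fixes A :: "real^'m^'n"
  shows "(A *v x) \<bullet> y = x \<bullet> (transpose A *v y)"
  using dot_lmul_matrix[of x "transpose A" y] by simp

text \<open>Cyclicity of the trace: a factor on the right crosses the pairing as its
  transpose.\<close>

lemma inner_mult_right:
  fixes A :: "real^'m^'n" and B :: "real^'k^'n" and C :: "real^'m^'k"
  shows "A \<bullet> (B ** C) = (A ** transpose C) \<bullet> B"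
proof -
  have "A \<bullet> (B ** C) = (B ** C) \<bullet> A"
    by (rule inner_commute)
  also have "\<dots> = trace (transpose C ** (transpose B ** A))"
    by (simp only: frob_inner_eq_inner[symmetric] frob_inner_def matrix_transpose_mul matrix_mul_assoc)
  also have "\<dots> = trace ((transpose B ** A) ** transpose C)"
    by (rule trace_mul_sym)
  also have "\<dots> = B \<bullet> (A ** transpose C)"
    by (simp only: frob_inner_eq_inner[symmetric] frob_inner_def matrix_mul_assoc)
  finally show ?thesis
    by (simp add: inner_commute)
qed

lemma inner_transpose:
  fixes A B :: "real^'m^'n"
  shows "transpose A \<bullet> transpose B = A \<bullet> B"
  using trace_mul_sym[of A "transpose B"] inner_commute[of A B]
  by (simp add: frob_inner_eq_inner[symmetric] frob_inner_def)

lemma norm_transpose: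
  fixes A :: "real^'m^'n"
  shows "norm (transpose A) = norm A"
  by (simp add: norm_eq_sqrt_inner inner_transpose)

lemma inner_mult_left:
  fixes A :: "real^'m^'n" and B :: "real^'k^'n" and C :: "real^'m^'k"
  shows "A \<bullet> (B ** C) = (transpose B ** A) \<bullet> C"
proof -
  have "A \<bullet> (B ** C) = transpose A \<bullet> (transpose C ** transpose B)"
    by (simp add: inner_transpose flip: matrix_transpose_mul)
  also have "\<dots> = transpose (transpose B ** A) \<bullet> transpose C"
    by (simp add: inner_mult_right matrix_transpose_mul)
  finally show ?thesis
    by (simp add: inner_transpose)
qed

lemma norm_sq_columns:
  fixes A :: "real^'m^'n"
  shows "(norm A)\<^sup>2 = (\<Sum>j\<in>UNIV. (norm (column j A))\<^sup>2)"
proof -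
  have "(norm A)\<^sup>2 = (\<Sum>i\<in>UNIV. \<Sum>j\<in>UNIV. A $ i $ j * A $ i $ j)"
    by (simp add: power2_norm_eq_inner inner_vec_def)
  also have "\<dots> = (\<Sum>j\<in>UNIV. \<Sum>i\<in>UNIV. A $ i $ j * A $ i $ j)"
    by (rule sum.swap)
  also have "\<dots> = (\<Sum>j\<in>UNIV. (norm (column j A))\<^sup>2)"
    by (simp add: power2_norm_eq_inner inner_vec_def column_def)
  finally show ?thesis .
qed

lemma column_matrix_mult:
  fixes A :: "real^'m^'n" and B :: "real^'k^'m"
  shows "column j (A ** B) = A *v column j B"
  by (simp add: column_def matrix_matrix_mult_def matrix_vector_mult_def vec_eq_iff)

section \<open>Contractions and matrices with orthonormal columns\<close>

text \<open>The squared Frobenius norm is a sum over columns, and \<open>A\<close> acts on each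
  column of \<open>B\<close> separately.\<close>

lemma norm_contraction_mult_le:
  fixes A :: "real^'m^'n" and B :: "real^'k^'m"
  assumes "\<And>v. norm (A *v v) \<le> norm v"
  shows "norm (A ** B) \<le> norm B"
proof (rule power2_le_imp_le)
  show "(norm (A ** B))\<^sup>2 \<le> (norm B)\<^sup>2"
    unfolding norm_sq_columns column_matrix_mult by (intro sum_mono power_mono assms) simp
qed simp

lemma norm_orthonormal_mult_vec:
  fixes Q :: "real^'m^'n"
  assumes "transpose Q ** Q = mat 1"
  shows "norm (Q *v v) = norm v"
proof -
  have "(Q *v v) \<bullet> (Q *v v) = v \<bullet> v"
    using assms by (simp add: inner_mult_vec_left matrix_vector_mul_assoc
        del: transpose_matrix_vector)
  then show ?thesis
    by (simp add: norm_eq_sqrt_inner)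
qed

text \<open>Cauchy-Schwarz for \<open>v\<close> and \<open>Q *v (transpose Q *v v)\<close>, where
  the outer \<open>Q\<close> is an isometry, leaves one factor
  \<open>norm (transpose Q *v v)\<close> to cancel.\<close>

lemma norm_transpose_orthonormal_mult_vec_le:
  fixes Q :: "real^'m^'n"
  assumes "transpose Q ** Q = mat 1"
  shows "norm (transpose Q *v v) \<le> norm v"
proof -
  have "(norm (transpose Q *v v))\<^sup>2 = v \<bullet> (Q *v (transpose Q *v v))"
    by (simp add: power2_norm_eq_inner inner_mult_vec_left del: transpose_matrix_vector)
  also have "\<dots> \<le> norm v * norm (transpose Q *v v)"
    using norm_cauchy_schwarz[of v "Q *v (transpose Q *v v)"]
    by (simp only: norm_orthonormal_mult_vec[OF assms])
  finally show ?thesis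
    by (cases "norm (transpose Q *v v) = 0") (auto simp: power2_eq_square simp del: transpose_matrix_vector)
qed

lemma norm_mult_orthonormal_le:
  fixes Q :: "real^'m^'n" and A :: "real^'n^'k"
  assumes "transpose Q ** Q = mat 1"
  shows "norm (A ** Q) \<le> norm A"
proof -
  have "norm (transpose Q ** transpose A) \<le> norm (transpose A)"
    by (intro norm_contraction_mult_le norm_transpose_orthonormal_mult_vec_le assms)
  then show ?thesis
    by (simp add: norm_transpose flip: matrix_transpose_mul)
qed

lemma norm_mult_transpose_orthonormal_le:
  fixes Q :: "real^'m^'n" and A :: "real^'m^'k"
  assumes "transpose Q ** Q = mat 1"
  shows "norm (A ** transpose Q) \<le> norm A"
proof -
  have "norm (Q ** transpose A) \<le> norm (transpose A)"
    by (intro norm_contraction_mult_le) (simp add: norm_orthonormal_mult_vec[OF assms])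
  then have "norm (transpose (Q ** transpose A)) \<le> norm A"
    by (simp only: norm_transpose)
  then show ?thesis
    by (simp add: matrix_transpose_mul)
qed

section \<open>Skew parts and polar factors\<close>

lemma transpose_skew_part: "transpose (skew_part A) = - skew_part A"
  by (simp add: skew_part_def transpose_linear scaleR_diff_right)

text \<open>Symmetric and skew matrices are orthogonal. Hence replacing a polar factor of a skew
  matrix by its skew part costs nothing in the pairing.\<close>

lemma inner_skew_part_right:
  assumes "transpose N = - N"
  shows "N \<bullet> skew_part A = N \<bullet> A"
proof -
  have "N \<bullet> transpose A = - (N \<bullet> A)"
    using inner_transpose[of N "transpose A"] assms by simp
  then show ?thesis
    by (simp add: skew_part_def inner_diff_right)
qed

text \<open>The skew part is the average of the two isometries \<open>W\<close> and
  \<open>- transpose W\<close>.\<close>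

lemma norm_skew_part_orthogonal_mult_vec_le:
  assumes "orthogonal_matrix W"
  shows "norm (skew_part W *v v) \<le> norm v"
proof -
  have "norm (W *v v) = norm v" "norm (transpose W *v v) = norm v"
    using assms by (simp_all add: norm_orthonormal_mult_vec orthogonal_matrix_def
        del: transpose_matrix_vector)
  moreover have "skew_part W *v v = (1/2) *\<^sub>R (W *v v - transpose W *v v)"
    by (simp add: skew_part_def scaleR_matrix_vector_assoc[symmetric] matrix_vector_mult_diff_rdistrib
        del: transpose_matrix_vector)
  ultimately show ?thesis
    using norm_triangle_ineq4[of "W *v v" "transpose W *v v"]
    by (simp del: transpose_matrix_vector)
qed

text \<open>The Euclidean norm of the singular values is at most their sum.\<close>

lemma norm_diagonal_le_trace:
  fixes S :: "real^'k^'k"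
  assumes "\<And>i j. i \<noteq> j \<Longrightarrow> S $ i $ j = 0" and "\<And>i. S $ i $ i \<ge> 0"
  shows "norm S \<le> trace S"
proof -
  have "norm S \<le> (\<Sum>i\<in>UNIV. norm (S $ i))"
    unfolding norm_vec_def by (intro L2_set_le_sum) simp
  also have "\<dots> \<le> (\<Sum>i\<in>UNIV. \<Sum>j\<in>UNIV. \<bar>S $ i $ j\<bar>)"
    by (intro sum_mono norm_le_l1_cart)
  also have "\<dots> = (\<Sum>i\<in>UNIV. \<Sum>j\<in>UNIV. if j = i then S $ i $ i else 0)"
    using assms by (intro sum.cong refl) auto
  also have "\<dots> = trace S"
    by (simp add: trace_def)
  finally show ?thesis .
qed

lemma polar_factor_orthogonal:
  assumes "is_polar_factor A W"
  shows "orthogonal_matrix W"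
  using assms unfolding is_polar_factor_def is_svd_def
  by (auto intro: orthogonal_matrix_mul)

text \<open>Pairing with the polar factor gives the nuclear norm, which dominates the Frobenius norm.\<close>

lemma norm_le_inner_polar_factor:
  assumes "is_polar_factor A W"
  shows "norm A \<le> A \<bullet> W"
proof -
  obtain U S V where svd: "is_svd A U S V" and W: "W = U ** transpose V"
    using assms unfolding is_polar_factor_def by blast
  then have U: "transpose U ** U = mat 1" and V: "transpose V ** V = mat 1"
    and S: "\<And>i j. i \<noteq> j \<Longrightarrow> S $ i $ j = 0" "\<And>i. S $ i $ i \<ge> 0"
    and A: "A = U ** S ** transpose V"
    by (auto simp: is_svd_def orthogonal_matrix_def)
  have "norm A \<le> norm (U ** S)"
    unfolding A by (rule norm_mult_transpose_orthonormal_le[OF V])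
  also have "\<dots> \<le> norm S"
    by (intro norm_contraction_mult_le) (simp add: norm_orthonormal_mult_vec[OF U])
  also have "\<dots> \<le> trace S"
    by (intro norm_diagonal_le_trace S)
  also have "\<dots> = A \<bullet> W"
  proof -
    \<comment> \<open>The orthogonal factors cancel one after the other: first \<open>V\<close>,
      moved across from \<open>W\<close>, then \<open>U\<close>.\<close>
    have "A \<bullet> W = (U ** (S ** (transpose V ** V))) \<bullet> U"
      by (simp only: A W inner_mult_right transpose_transpose matrix_mul_assoc)
    also have "\<dots> = U \<bullet> (U ** S)"
      by (simp add: V inner_commute)
    also have "\<dots> = mat 1 \<bullet> S"
      by (simp add: inner_mult_left U)
    also have "\<dots> = trace S"
      by (simp add: frob_inner_eq_inner[symmetric] frob_inner_def)
    finally show ?thesis ..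
  qed
  finally show ?thesis .
qed

section \<open>Multipliers that produce descent directions\<close>

text \<open>Common interface of the two algorithms: skewness makes \<open>Y ** X\<close> tangent,
  contractivity bounds its length, and the last condition controls the first-order decrease.\<close>

definition descent_multiplier :: "real^'k^'k \<Rightarrow> real^'k^'k \<Rightarrow> bool" where
  "descent_multiplier N Y \<longleftrightarrow>
     transpose Y = - Y \<and> (\<forall>v. norm (Y *v v) \<le> norm v) \<and> N \<bullet> Y \<le> - norm N"

lemma descent_multiplier_polar:
  assumes "transpose N = - N" and "is_polar_factor N W"
  shows "descent_multiplier N (- skew_part W)"
proof -
  have "transpose (- skew_part W) = - (- skew_part W)"
    by (simp add: transpose_linear transpose_skew_part)
  moreover have "norm (- skew_part W *v v) \<le> norm v" for v
    using norm_skew_part_orthogonal_mult_vec_le[OF polar_factor_orthogonal[OF assms(2)], of v]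
    \<comment> \<open>Distributivity over \<open>0 - skew_part W\<close> supplies the rule for
      negation.\<close>
    using matrix_vector_mult_diff_rdistrib[of 0 "skew_part W" v] by simp
  moreover have "N \<bullet> (- skew_part W) \<le> - norm N"
    using norm_le_inner_polar_factor[OF assms(2)] by (simp add: inner_skew_part_right[OF assms(1)])
  ultimately show ?thesis
    unfolding descent_multiplier_def by blast
qed

text \<open>As \<open>Q\<close> is an isometric embedding, conjugation keeps the pairing and does
  not increase the norm of \<open>N\<close>, so the descent bound survives; contractivity passes
  through the three factors.\<close>

lemma descent_multiplier_conjugate:
  fixes Q :: "real^'k^'n"
  assumes Q: "transpose Q ** Q = mat 1" and "descent_multiplier N Y"
  shows "descent_multiplier (Q ** N ** transpose Q) (Q ** Y ** transpose Q)"
proof -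
  have Y: "transpose Y = - Y" "\<And>v. norm (Y *v v) \<le> norm v" "N \<bullet> Y \<le> - norm N"
    using assms(2) unfolding descent_multiplier_def by auto
  have "transpose (Q ** Y ** transpose Q) = Q ** transpose Y ** transpose Q"
    by (simp only: matrix_transpose_mul transpose_transpose matrix_mul_assoc)
  also have "\<dots> = - (Q ** Y ** transpose Q)"
    by (simp add: Y matrix_mult_bilinear)
  finally have skew: "transpose (Q ** Y ** transpose Q) = - (Q ** Y ** transpose Q)" .
  have contr: "norm ((Q ** Y ** transpose Q) *v v) \<le> norm v" for v
  proof -
    have "norm ((Q ** Y ** transpose Q) *v v) = norm (Q *v (Y *v (transpose Q *v v)))"
      by (simp only: matrix_vector_mul_assoc matrix_mul_assoc)
    also have "\<dots> \<le> norm (transpose Q *v v)"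
      by (simp add: norm_orthonormal_mult_vec[OF Q] Y)
    also have "\<dots> \<le> norm v"
      by (rule norm_transpose_orthonormal_mult_vec_le[OF Q])
    finally show ?thesis .
  qed
  have "norm (Q ** N ** transpose Q) \<le> norm (Q ** N)"
    by (rule norm_mult_transpose_orthonormal_le[OF Q])
  also have "\<dots> \<le> norm N"
    by (intro norm_contraction_mult_le) (simp add: norm_orthonormal_mult_vec[OF Q])
  finally have le: "norm (Q ** N ** transpose Q) \<le> norm N" .
  have "(Q ** N ** transpose Q) \<bullet> (Q ** Y ** transpose Q)
      = (Q ** (N ** (transpose Q ** Q))) \<bullet> (Q ** Y)"
    by (simp only: inner_mult_right transpose_transpose matrix_mul_assoc)
  also have "\<dots> = ((transpose Q ** Q) ** N) \<bullet> Y"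
    by (simp only: Q matrix_mul_rid inner_mult_left matrix_mul_assoc)
  also have "\<dots> = N \<bullet> Y"
    by (simp add: Q)
  finally have "(Q ** N ** transpose Q) \<bullet> (Q ** Y ** transpose Q) = N \<bullet> Y" .
  with skew contr le Y(3) show ?thesis
    unfolding descent_multiplier_def by auto
qed

section \<open>Block matrices and the low-rank form of the skew part\<close>

lemma sum_UNIV_Plus:
  fixes h :: "'a::finite + 'b::finite \<Rightarrow> 'c::comm_monoid_add"
  shows "(\<Sum>k\<in>UNIV. h k) = (\<Sum>i\<in>UNIV. h (Inl i)) + (\<Sum>j\<in>UNIV. h (Inr j))"
  using sum.Plus[of UNIV UNIV h] by (simp add: comp_def)

lemma hblock_mult_vblock: "hblock A B ** vblock C D = A ** C + B ** D"
  by (simp add: vec_eq_iff hblock_def vblock_def matrix_matrix_mult_def sum_UNIV_Plus)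

lemma mult_hblock: "A ** hblock B C = hblock (A ** B) (A ** C)"
  by (simp add: vec_eq_iff hblock_def matrix_matrix_mult_def split: sum.split)

lemma hblock_add: "hblock A B + hblock C D = hblock (A + C) (B + D)"
  by (simp add: vec_eq_iff hblock_def split: sum.split)

lemma transpose_hblock: "transpose (hblock A B) = vblock (transpose A) (transpose B)"
  by (simp add: vec_eq_iff hblock_def vblock_def transpose_def split: sum.split)

text \<open>Multiplication by \<open>Jmat\<close> swaps the blocks up to sign, giving
  \<open>M ** transpose X - X ** transpose M\<close>. Through this factorization a QR decomposition
  of the block matrix reduces the polar factor to size 2p.\<close>

lemma hblock_Jmat_transpose:
  "(1/2) *\<^sub>R (hblock (- X) M ** Jmat ** transpose (hblock (- X) M)) = skew_part (M ** transpose X)"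
proof -
  have "hblock (- X) M ** Jmat = hblock (- M) (- X)"
    by (simp add: Jmat_def hblock_mult_vblock mult_hblock hblock_add matrix_mult_bilinear)
  then have "hblock (- X) M ** Jmat ** transpose (hblock (- X) M)
      = M ** transpose X - X ** transpose M"
    by (simp add: transpose_hblock hblock_mult_vblock transpose_linear matrix_mult_bilinear)
  then show ?thesis
    by (simp add: skew_part_def matrix_transpose_mul)
qed

section \<open>Geometry of the Stiefel manifold\<close>

text \<open>Tangency of \<open>B\<close> means that \<open>transpose X ** B\<close> is skew, and the
  projection removes exactly the symmetric part of \<open>transpose X ** G\<close>.\<close>

lemma tangent_proj_tangent:
  assumes "X \<in> stiefel"
  shows "tangent_proj X G \<in> stiefel_tangent X"
proof -
  have X: "transpose X ** X = mat 1"
    using assms by (simp add: stiefel_def)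
  have eq: "transpose X ** tangent_proj X G = skew_part (transpose X ** G)"
    unfolding tangent_proj_def
    by (simp add: matrix_mult_bilinear matrix_mul_assoc X sym_part_def skew_part_def)
      (simp add: vec_eq_iff field_simps)
  have "transpose (tangent_proj X G) ** X = transpose (transpose X ** tangent_proj X G)"
    by (simp add: matrix_transpose_mul)
  then show ?thesis
    by (simp add: stiefel_tangent_def eq transpose_skew_part)
qed

text \<open>The removed term pairs a symmetric matrix with the skew matrix
  \<open>transpose X ** B\<close>, hence contributes zero.\<close>

lemma inner_tangent_proj:
  assumes "B \<in> stiefel_tangent X"
  shows "tangent_proj X G \<bullet> B = G \<bullet> B"
proof -
  have "transpose (transpose X ** B) = - (transpose X ** B)"
    using assms by (simp add: stiefel_tangent_def matrix_transpose_mul eq_neg_iff_add_eq_0 add.commute)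
  then have "(transpose X ** B) \<bullet> sym_part A = 0" for A
    using inner_transpose[of "transpose X ** B" A] inner_transpose[of "transpose X ** B" "transpose A"]
    by (simp add: sym_part_def inner_add_right)
  then have "B \<bullet> (X ** sym_part (transpose X ** G)) = 0"
    by (simp add: inner_mult_left)
  then show ?thesis
    by (simp add: tangent_proj_def inner_diff_left inner_diff_right inner_commute)
qed

text \<open>With \<open>N = skew_part (G X\<^sup>T)\<close>, the projected gradient is \<open>N X + (I - X X\<^sup>T) N X\<close>.\<close>

lemma norm_tangent_proj_le:
  fixes X G :: "real^'p^'n"
  assumes "X \<in> stiefel"
  shows "norm (tangent_proj X G) \<le> 2 * norm (skew_part (G ** transpose X))"
proof -
  have X: "transpose X ** X = mat 1"
    using assms by (simp add: stiefel_def)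
  define N where "N = skew_part (G ** transpose X)"
  have NX: "N ** X = (1/2) *\<^sub>R (G - X ** transpose G ** X)"
    unfolding N_def skew_part_def
    by (simp add: matrix_transpose_mul matrix_mult_bilinear matrix_mul_assoc[symmetric] X)
  have "tangent_proj X G = N ** X + (mat 1 - X ** transpose X) ** (N ** X)"
  proof -
    have "transpose X ** (X ** Z) = Z" for Z :: "real^'p^'p"
      by (simp add: matrix_mul_assoc X)
    then show ?thesis
      unfolding NX tangent_proj_def sym_part_def
      by (simp add: matrix_transpose_mul matrix_mult_bilinear matrix_mul_assoc[symmetric])
        (simp add: vec_eq_iff field_simps)
  qed
  moreover have "norm ((mat 1 - X ** transpose X) *v v) \<le> norm v" for v
  proof (rule power2_le_imp_le)
    \<comment> \<open>\<open>w\<close> is the orthogonal projection of \<open>v\<close> onto the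
      column space of \<open>X\<close>; Pythagoras then bounds \<open>v - w\<close>.\<close>
    define w where "w = X *v (transpose X *v v)"
    have "w \<bullet> w = (transpose X *v v) \<bullet> (transpose X *v v)"
      by (simp add: w_def power2_norm_eq_inner[symmetric] norm_orthonormal_mult_vec[OF X])
    also have "\<dots> = w \<bullet> v"
      by (simp add: w_def inner_mult_vec_left del: transpose_matrix_vector)
    finally have "w \<bullet> w = w \<bullet> v" .
    then have "(norm (v - w))\<^sup>2 = (norm v)\<^sup>2 - (norm w)\<^sup>2"
      by (simp add: power2_norm_eq_inner algebra_simps inner_commute)
    then show "(norm ((mat 1 - X ** transpose X) *v v))\<^sup>2 \<le> (norm v)\<^sup>2"
      by (simp add: w_def matrix_vector_mult_diff_rdistrib matrix_vector_mul_assoc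
          del: transpose_matrix_vector)
  qed simp
  then have "norm ((mat 1 - X ** transpose X) ** (N ** X)) \<le> norm (N ** X)"
    by (rule norm_contraction_mult_le)
  moreover have "norm (N ** X) \<le> norm N"
    by (rule norm_mult_orthonormal_le[OF X])
  ultimately show ?thesis
    unfolding N_def[symmetric] by (smt (verit) norm_triangle_ineq)
qed

lemma norm_sq_stiefel:
  fixes X :: "real^'p^'n"
  assumes "X \<in> stiefel"
  shows "(norm X)\<^sup>2 = real CARD('p)"
proof -
  have "(norm X)\<^sup>2 = frob_inner X X"
    by (simp add: frob_inner_eq_inner power2_norm_eq_inner)
  also have "\<dots> = trace (mat 1 :: real^'p^'p)"
    using assms by (simp add: frob_inner_def stiefel_def)
  finally show ?thesis
    by (simp add: trace_I)
qed

text \<open>A closed subset of a sphere of squared radius p. Compactness will bound the objective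
  from below.\<close>

lemma compact_stiefel: "compact (stiefel :: (real^'p^'n) set)"
proof -
  have "bounded (stiefel :: (real^'p^'n) set)"
    unfolding bounded_iff
  proof (intro exI ballI)
    fix X :: "real^'p^'n" assume "X \<in> stiefel"
    then show "norm X \<le> sqrt (real CARD('p))"
      by (simp add: real_le_rsqrt norm_sq_stiefel)
  qed
  moreover have "closed (stiefel :: (real^'p^'n) set)"
    unfolding stiefel_def transpose_def matrix_matrix_mult_def
    by (intro closed_Collect_eq continuous_intros)
  ultimately show ?thesis
    by (simp add: compact_eq_bounded_closed)
qed

text \<open>Only the skew part of \<open>G ** transpose X\<close> meets the skew \<open>Y\<close>,
  and its norm is at least half that of the projected gradient. The length bound holds because
  \<open>Y\<close> contracts the columns of \<open>X\<close>.\<close>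

lemma descent_direction:
  fixes X G :: "real^'p^'n"
  assumes X: "X \<in> stiefel" and Y: "descent_multiplier (skew_part (G ** transpose X)) Y"
  shows "Y ** X \<in> stiefel_tangent X"
    and "tangent_proj X G \<bullet> (Y ** X) \<le> - norm (tangent_proj X G) / 2"
    and "(norm (Y ** X))\<^sup>2 \<le> real CARD('p)"
proof -
  define N where "N = skew_part (G ** transpose X)"
  have Y: "transpose Y = - Y" "\<And>v. norm (Y *v v) \<le> norm v" "N \<bullet> Y \<le> - norm N"
    using Y unfolding descent_multiplier_def N_def by auto
  have "transpose X ** (Y ** X) + transpose (Y ** X) ** X = 0"
    by (simp only: matrix_transpose_mul Y(1) matrix_mul_assoc matrix_mult_bilinear right_minus)
  then show tangent: "Y ** X \<in> stiefel_tangent X"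
    by (simp only: stiefel_tangent_def mem_Collect_eq)
  have "tangent_proj X G \<bullet> (Y ** X) = (G ** transpose X) \<bullet> Y"
    using inner_tangent_proj[OF tangent] inner_mult_right by (rule trans)
  also have "\<dots> = N \<bullet> Y"
    using inner_skew_part_right[OF Y(1), of "G ** transpose X"] by (simp add: N_def inner_commute)
  finally show "tangent_proj X G \<bullet> (Y ** X) \<le> - norm (tangent_proj X G) / 2"
    using norm_tangent_proj_le[OF X, of G] Y(3) by (simp add: N_def)
  show "(norm (Y ** X))\<^sup>2 \<le> real CARD('p)"
    using norm_contraction_mult_le[of Y X] Y(2) norm_sq_stiefel[OF X] by (metis norm_ge_zero power_mono)
qed

section \<open>The steps of the two algorithms\<close>

lemma alg1_descent_multiplier:
  assumes "alg1_iterates R T M \<eta> X" and "t < T"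
  shows "\<exists>Y. descent_multiplier (skew_part (M t ** transpose (X t))) Y \<and>
    X (Suc t) = R (X t) (\<eta> t *\<^sub>R (Y ** X t))"
  using assms descent_multiplier_polar[OF transpose_skew_part]
  unfolding alg1_iterates_def Let_def by blast

text \<open>The multiplier is the small one conjugated by \<open>Q\<close>; reassociating the
  products recovers the update of the algorithm.\<close>

lemma alg2_descent_multiplier:
  assumes "alg2_iterates R T M \<eta> X" and "t < T"
  shows "\<exists>Y. descent_multiplier (skew_part (M t ** transpose (X t))) Y \<and>
    X (Suc t) = R (X t) (\<eta> t *\<^sub>R (Y ** X t))"
proof -
  obtain Q S W where QR: "is_thin_qr (hblock (- X t) (M t)) Q S"
    and W: "is_polar_factor ((1/2) *\<^sub>R (S ** Jmat ** transpose S)) W"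
    and step: "X (Suc t) = R (X t) (\<eta> t *\<^sub>R (Q ** ((- skew_part W) ** (transpose Q ** X t))))"
    using assms unfolding alg2_iterates_def Let_def by blast
  define N where "N = (1/2) *\<^sub>R (S ** Jmat ** transpose S)"
  have Q: "transpose Q ** Q = mat 1" and K: "hblock (- X t) (M t) = Q ** S"
    using QR unfolding is_thin_qr_def by auto
  have conj: "skew_part (M t ** transpose (X t)) = Q ** N ** transpose Q"
    unfolding hblock_Jmat_transpose[symmetric] K N_def
    by (simp add: matrix_transpose_mul matrix_mul_assoc matrix_mult_bilinear)
  \<comment> \<open>The compressed matrix inherits skewness from the full one.\<close>
  have N: "N = transpose Q ** skew_part (M t ** transpose (X t)) ** Q"
    unfolding conj by (metis Q matrix_mul_assoc matrix_mul_lid matrix_mul_rid)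
  have "transpose N = - N"
    by (subst (1 2) N) (simp add: matrix_transpose_mul transpose_skew_part matrix_mul_assoc
        matrix_mult_bilinear)
  then have "descent_multiplier N (- skew_part W)"
    using W unfolding N_def by (rule descent_multiplier_polar)
  then have "descent_multiplier (skew_part (M t ** transpose (X t))) (Q ** (- skew_part W) ** transpose Q)"
    unfolding conj by (rule descent_multiplier_conjugate[OF Q])
  moreover have "X (Suc t) = R (X t) (\<eta> t *\<^sub>R ((Q ** (- skew_part W) ** transpose Q) ** X t))"
    by (simp only: step matrix_mul_assoc)
  ultimately show ?thesis
    by blast
qed

section \<open>Telescoping the descent inequality\<close>

theorem theorem3:
  fixes f :: "real^'p::{finite,linorder}^'n \<Rightarrow> real"
    and U :: "(real^'p::{finite,linorder}^'n) set"
    and R :: "real^'p::{finite,linorder}^'n \<Rightarrow> real^'p::{finite,linorder}^'n \<Rightarrow> real^'p::{finite,linorder}^'n"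
    and X :: "nat \<Rightarrow> real^'p::{finite,linorder}^'n"
    and L \<Delta> \<eta> :: real
    and T :: nat
  assumes "CARD('p) < CARD('n)"
    and "T \<ge> 1"
    and "open U" and "stiefel \<subseteq> U" and "smooth_on U f"
    and "retraction_on_stiefel R"
    and "L > 0"
    and "\<And>Z B. Z \<in> stiefel \<Longrightarrow> B \<in> stiefel_tangent Z \<Longrightarrow>
           f (R Z B) \<le> f Z + frob_inner (riem_grad f Z) B + L / 2 * (frob_norm B)\<^sup>2"
    and "X 0 \<in> stiefel"
    and "\<Delta> \<ge> f (X 0) - (INF Z\<in>stiefel. f Z)"
    and "\<eta> = sqrt (2 * \<Delta> / (real CARD('p) * L * real T))"
    and "alg1_iterates R T (\<lambda>t. euclid_grad f (X t)) (\<lambda>_. \<eta>) X \<or>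
         2 * CARD('p) \<le> CARD('n) \<and>
         alg2_iterates R T (\<lambda>t. euclid_grad f (X t)) (\<lambda>_. \<eta>) X"
  shows "Min ((\<lambda>t. frob_norm (riem_grad f (X t))) ` {..<T})
           \<le> sqrt (8 * real CARD('p) * \<Delta> * L / real T)"
proof -
  define g where "g t = norm (riem_grad f (X t))" for t
  define m where "m = Min (g ` {..<T})"
  define p where "p = real CARD('p)"
  define I where "I = (INF Z\<in>stiefel. f Z)"
  have "p > 0" "real T > 0" "L > 0"
    using assms by (auto simp: p_def)
  have retr: "R Z B \<in> stiefel" if "Z \<in> stiefel" "B \<in> stiefel_tangent Z" for Z B
    using assms(6) that unfolding retraction_on_stiefel_def by blast
  have descent: "f (R Z B) \<le> f Z + riem_grad f Z \<bullet> B + L / 2 * (norm B)\<^sup>2"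
    if "Z \<in> stiefel" "B \<in> stiefel_tangent Z" for Z B
    using assms(8)[OF that] by (simp add: frob_inner_eq_inner frob_norm_eq_norm)
  have scale: "c *\<^sub>R B \<in> stiefel_tangent Z" if "B \<in> stiefel_tangent Z"
    for c and B Z :: "real^'p::{finite,linorder}^'n"
  proof -
    have "transpose Z ** (c *\<^sub>R B) + transpose (c *\<^sub>R B) ** Z
        = c *\<^sub>R (transpose Z ** B + transpose B ** Z)"
      by (simp add: vec_eq_iff matrix_matrix_mult_def transpose_def sum_distrib_left algebra_simps)
    then show ?thesis
      using that by (simp add: stiefel_tangent_def)
  qed
  \<comment> \<open>On the reals \<open>INF\<close> is known to be a lower bound once the set is
    bounded below; compactness gives this.\<close>
  have "continuous_on stiefel f"
    using assms(4,5) unfolding smooth_on_def by (metis Ck_on.simps(1) continuous_on_subset)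
  then have "bdd_below (f ` stiefel)"
    by (intro bounded_imp_bdd_below compact_imp_bounded compact_continuous_image compact_stiefel)
  then have I_le: "I \<le> f Z" if "Z \<in> stiefel" for Z
    unfolding I_def using that by (rule cINF_lower)
  have \<Delta>: "f (X 0) - I \<le> \<Delta>" and "\<Delta> \<ge> 0"
    using assms(10) I_le[OF assms(9)] by (auto simp: I_def)
  have m_le: "m \<le> g t" if "t < T" for t
    unfolding m_def using that by (intro Min_le) auto
  have "\<eta> \<ge> 0"
    using assms(11) \<open>\<Delta> \<ge> 0\<close> \<open>L > 0\<close> by simp
  have step: "X (Suc t) \<in> stiefel \<and> f (X (Suc t)) \<le> f (X t) - \<eta> * g t / 2 + L * p / 2 * \<eta>\<^sup>2"
    if t: "t < T" and Xt: "X t \<in> stiefel" for t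
  proof -
    \<comment> \<open>From here on the two algorithms are treated alike.\<close>
    obtain Y where Y: "descent_multiplier (skew_part (euclid_grad f (X t) ** transpose (X t))) Y"
      and Suc: "X (Suc t) = R (X t) (\<eta> *\<^sub>R (Y ** X t))"
      using assms(12) alg1_descent_multiplier[OF _ t] alg2_descent_multiplier[OF _ t] by blast
    note dir = descent_direction[OF Xt Y, folded riem_grad_def]
    have tangent: "\<eta> *\<^sub>R (Y ** X t) \<in> stiefel_tangent (X t)"
      by (rule scale[OF dir(1)])
    have "riem_grad f (X t) \<bullet> (\<eta> *\<^sub>R (Y ** X t)) \<le> - (\<eta> * g t / 2)"
      using mult_left_mono[OF dir(2) \<open>\<eta> \<ge> 0\<close>] by (simp add: g_def)
    moreover have "L / 2 * (norm (\<eta> *\<^sub>R (Y ** X t)))\<^sup>2 \<le> L * p / 2 * \<eta>\<^sup>2"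
      using mult_left_mono[OF dir(3), of "L / 2 * \<eta>\<^sup>2"] \<open>L > 0\<close>
      by (simp add: power_mult_distrib p_def algebra_simps)
    ultimately show ?thesis
      using descent[OF Xt tangent] retr[OF Xt tangent] Suc by simp
  qed
  \<comment> \<open>Replacing \<open>g t\<close> by the minimum \<open>m\<close> makes the
    guaranteed change the same at every step. The range includes \<open>t = T\<close>, since the
    last iterate is compared with the infimum.\<close>
  have iter: "X t \<in> stiefel \<and> f (X t) \<le> f (X 0) - real t * (\<eta> * m / 2 - L * p / 2 * \<eta>\<^sup>2)"
    if "t \<le> T" for t
    using that
  proof (induction t)
    case 0
    then show ?case using assms(9) by simp
  next
    case (Suc t)
    then have IH: "X t \<in> stiefel" "f (X t) \<le> f (X 0) - real t * (\<eta> * m / 2 - L * p / 2 * \<eta>\<^sup>2)"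
      and t: "t < T"
      by auto
    have "\<eta> * m \<le> \<eta> * g t"
      using m_le[OF t] \<open>\<eta> \<ge> 0\<close> by (rule mult_left_mono)
    with step[OF t IH(1)] IH(2) show ?case
      by (auto simp: algebra_simps add_divide_distrib)
  qed
  have "m \<ge> 0"
    unfolding m_def using \<open>T \<ge> 1\<close> by (intro Min.boundedI) (auto simp: g_def lessThan_empty_iff)
  have "m \<le> sqrt (8 * p * \<Delta> * L / real T)"
  proof (cases "\<Delta> = 0")
    case True
    \<comment> \<open>Here \<open>\<eta> = 0\<close> and the iterates carry no information, but \<open>X 0\<close> is a minimizer,
      so a gradient step of length \<open>1 / L\<close> cannot decrease \<open>f\<close>.\<close>
    let ?B = "(- 1 / L) *\<^sub>R riem_grad f (X 0)"
    have tangent: "?B \<in> stiefel_tangent (X 0)"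
      unfolding riem_grad_def by (intro scale tangent_proj_tangent assms(9))
    have "f (X 0) \<le> f (R (X 0) ?B)"
      using \<Delta> True I_le[OF retr[OF assms(9) tangent]] by simp
    also have "\<dots> \<le> f (X 0) + riem_grad f (X 0) \<bullet> ?B + L / 2 * (norm ?B)\<^sup>2"
      by (rule descent[OF assms(9) tangent])
    \<comment> \<open>The linear term is \<open>- (g 0)\<^sup>2 / L\<close>, and the quadratic term
      gives back half of it.\<close>
    also have "\<dots> = f (X 0) - (g 0)\<^sup>2 / (2 * L)"
      using \<open>L > 0\<close> by (simp add: g_def power2_norm_eq_inner[symmetric]
          field_simps power2_eq_square)
    finally have "(g 0)\<^sup>2 \<le> 0"
      using \<open>L > 0\<close> by (simp add: field_simps)
    then have "g 0 = 0"
      by simp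
    with m_le[of 0] \<open>T \<ge> 1\<close> True show ?thesis
      by simp
  next
    case False
    then have "\<Delta> > 0"
      using \<open>\<Delta> \<ge> 0\<close> by simp
    have \<eta>2: "\<eta>\<^sup>2 = 2 * \<Delta> / (p * L * real T)"
      using assms(11) \<open>\<Delta> > 0\<close> \<open>L > 0\<close> by (simp add: p_def)
    have "real T * (\<eta> * m / 2 - L * p / 2 * \<eta>\<^sup>2) \<le> \<Delta>"
      using iter[of T] I_le[of "X T"] \<Delta> by auto
    \<comment> \<open>The step size is chosen so that the quadratic terms of all \<open>T\<close>
      steps add up to exactly \<Delta>.\<close>
    moreover have "real T * (L * p / 2 * \<eta>\<^sup>2) = \<Delta>"
      using \<open>p > 0\<close> \<open>L > 0\<close> \<open>real T > 0\<close> by (simp add: \<eta>2 field_simps)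
    ultimately have "real T * \<eta> * m \<le> 4 * \<Delta>"
      by (simp add: algebra_simps)
    \<comment> \<open>Squaring removes the root in \<eta>. The factor
      \<open>p * L / (2 * \<Delta>)\<close> used next equals
      \<open>1 / (real T * \<eta>\<^sup>2)\<close>, which turns the left side into
      \<open>real T * m\<^sup>2\<close>.\<close>
    then have "(real T * \<eta> * m)\<^sup>2 \<le> (4 * \<Delta>)\<^sup>2"
      using \<open>m \<ge> 0\<close> \<open>\<eta> \<ge> 0\<close> by (intro power_mono) auto
    then have "(real T * \<eta> * m)\<^sup>2 * (p * L / (2 * \<Delta>)) \<le> (4 * \<Delta>)\<^sup>2 * (p * L / (2 * \<Delta>))"
      using \<open>p > 0\<close> \<open>L > 0\<close> \<open>\<Delta> > 0\<close> by (intro mult_right_mono) auto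
    also have "(4 * \<Delta>)\<^sup>2 * (p * L / (2 * \<Delta>)) = 8 * p * \<Delta> * L"
      using \<open>\<Delta> > 0\<close> by (simp add: power2_eq_square)
    also have "(real T * \<eta> * m)\<^sup>2 * (p * L / (2 * \<Delta>)) = real T * m\<^sup>2"
      using \<open>p > 0\<close> \<open>L > 0\<close> \<open>\<Delta> > 0\<close> \<open>real T > 0\<close>
      by (simp add: power_mult_distrib \<eta>2) (simp add: power2_eq_square)
    finally have "m\<^sup>2 \<le> 8 * p * \<Delta> * L / real T"
      using \<open>real T > 0\<close> by (simp add: pos_le_divide_eq mult.commute)
    then show ?thesis
      by (rule real_le_rsqrt)
  qed
  then show ?thesis
    by (simp add: m_def g_def p_def frob_norm_eq_norm)
qed

end
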